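(* Let $n$ and $s$ be positive integers, let $L=\{\ell_1,\ell_2,\ldots,\ell_s\}$ be a set of $s$ distinct non-negative integers, and let $\mathcal{F}\subseteq 2^{[n]}$ be an $L$-intersecting Sperner family. Then $$|\mathcal{F}|\le \sum_{i=0}^{s}\binom{n-1}{i}.$$ Moreover, if $0\in L$ and $n\ge 3s^2$, then $|\mathcal{F}|\le\binom{n}{s}$, with equality if and only if $L=\{0,1,2,\ldots,s-1\}$ and $\mathcal{F}=\binom{[n]}{s}$.
   Context: $[n]=\{1,\ldots,n\}$ and $2^{[n]}$ is the family of all subsets of $[n]$; $\binom{[n]}{s}$ is the family of all $s$-element subsets of $[n]$. A family $\mathcal{F}\subseteq 2^{[n]}$ is $L$-intersecting if $|F\cap F'|\in L$ for any two distinct $F,F'\in\mathcal{F}$. A family $\mathcal{F}$ is Sperner if there are no distinct $A,B\in\mathcal{F}$ with $A\subseteq B$. *)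

theory Defs
  imports Main
begin

definition L_intersecting :: "nat set \<Rightarrow> 'a set set \<Rightarrow> bool" where
  "L_intersecting L \<F> \<longleftrightarrow> (\<forall>A\<in>\<F>. \<forall>B\<in>\<F>. A \<noteq> B \<longrightarrow> card (A \<inter> B) \<in> L)"

definition sperner_family :: "'a set set \<Rightarrow> bool" where
  "sperner_family \<F> \<longleftrightarrow> \<not> (\<exists>A\<in>\<F>. \<exists>B\<in>\<F>. A \<noteq> B \<and> A \<subseteq> B)"

end

theory Submission
  imports Defs Complex_Main "HOL-Library.Function_Algebras"
begin

text \<open>
  For the first bound, fix a point \<open>v\<close> of the ground set \<open>V\<close> and attach to each member \<open>A\<close> the
  function \<open>g\<^sub>A(X) = \<Prod>(|A \<inter> (X \<union> {v})| - l)\<close> on subsets \<open>X\<close> of \<open>V - {v}\<close>, the product being over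
  the \<open>l \<in> L\<close> below \<open>|A|\<close>. Since the family is Sperner, intersections with \<open>A\<close> are smaller than \<open>A\<close>,
  so evaluating at the points \<open>B - {v}\<close> gives a triangular system as soon as the members containing
  \<open>v\<close> are listed first. The \<open>g\<^sub>A\<close> are thus independent in the span of the multilinear monomials of
  degree at most \<open>s\<close> in \<open>|V| - 1\<close> variables.

  For the second bound, if \<open>L = {0..<s}\<close>, shrink every member larger than \<open>s\<close> to an \<open>s\<close>-subset; the
  result is an antichain of the same size with all sets of size at most \<open>s\<close>, and the LYM inequality
  applies. If \<open>L \<noteq> {0..<s}\<close>, the members of size at most \<open>s\<close> see at most \<open>s - 1\<close> elements of \<open>L\<close>, and
  so do the members through a fixed point, because their intersections are nonempty. The first bound
  with \<open>s - 1\<close> for \<open>s\<close> then controls both the small members and, by counting incidences,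
  the members of size at least \<open>s + 1\<close>.
\<close>

section \<open>Linear independence of real functions by triangular evaluation\<close>

interpretation fun_space: vector_space "\<lambda>(c::real) (f::'p \<Rightarrow> real) x. c * f x"
  by unfold_locales (auto simp: fun_eq_iff algebra_simps)

text \<open>Ordered by \<open>r\<close>, the matrix of values \<open>g i (y j)\<close> is triangular
  with nonzero diagonal, so the \<open>g i\<close> are independent. Ties in \<open>r\<close> are
  allowed: between indices of equal rank the values vanish in both directions.\<close>

lemma card_le_of_triangular:
  fixes g :: "'i \<Rightarrow> 'p \<Rightarrow> real" and r :: "'i \<Rightarrow> nat"
  assumes F: "finite F" and M: "finite M"
    and span: "\<And>i. i \<in> F \<Longrightarrow> g i \<in> fun_space.span M"
    and diag: "\<And>i. i \<in> F \<Longrightarrow> g i (y i) \<noteq> 0"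
    and off: "\<And>i j. i \<in> F \<Longrightarrow> j \<in> F \<Longrightarrow> i \<noteq> j \<Longrightarrow> r j \<le> r i \<Longrightarrow> g i (y j) = 0"
  shows "card F \<le> card M"
proof -
  have inj: "inj_on g F"
  proof (rule inj_onI)
    fix i j assume ij: "i \<in> F" "j \<in> F" "g i = g j"
    show "i = j"
      \<comment> \<open>If \<open>i \<noteq> j\<close>, whichever rank is smaller,
        \<open>off\<close> makes one of \<open>g i (y j)\<close>, \<open>g j (y i)\<close> zero,
        while \<open>g i = g j\<close> makes it a diagonal value.\<close>
      using off[of i j] off[of j i] diag[of i] diag[of j] ij nat_le_linear[of "r i" "r j"] by auto
  qed
  have "fun_space.independent (g ` F)"
  proof (rule fun_space.independent_if_scalars_zero)
    show "finite (g ` F)" using F by simp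
  next
    fix u h
    assume "(\<Sum>h\<in>g ` F. (\<lambda>x. u h * h x)) = 0" and h: "h \<in> g ` F"
    then have "(\<Sum>i\<in>F. (\<lambda>x. u (g i) * g i x)) = 0"
      by (simp add: sum.reindex[OF inj])
    moreover have "(\<Sum>i\<in>F. (\<lambda>x. u (g i) * g i x)) x = (\<Sum>i\<in>F. u (g i) * g i x)" for x
      using F by (induction F rule: finite_induct) auto
    ultimately have zero: "(\<Sum>i\<in>F. u (g i) * g i x) = 0" for x
      by (simp add: fun_eq_iff)
    have "u (g i) = 0" if "i \<in> F" for i
      using that
    proof (induction "r i" arbitrary: i rule: less_induct)
      case less
      \<comment> \<open>Lower ranks vanish by induction on the coefficient, all others by
        \<open>off\<close> at the point \<open>y i\<close>.\<close>
      have "u (g j) * g j (y i) = 0" if "j \<in> F - {i}" for j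
        using that less off[of j i] by (cases "r j < r i") auto
      then have "(\<Sum>j\<in>F - {i}. u (g j) * g j (y i)) = 0" by (intro sum.neutral) blast
      then have "(\<Sum>j\<in>F. u (g j) * g j (y i)) = u (g i) * g i (y i)"
        using F less.prems by (simp add: sum.remove)
      then show ?case using zero[of "y i"] diag[OF less.prems] by simp
    qed
    then show "u h = 0" using h by auto
  qed
  then have "card (g ` F) \<le> card M"
    using fun_space.independent_span_bound[OF M] span by blast
  then show ?thesis by (simp add: card_image[OF inj])
qed

section \<open>Multilinear polynomials on subsets\<close>

text \<open>A monomial \<open>\<Prod>\<^sub>i\<^sub>\<in>\<^sub>I x\<^sub>i\<close> is represented by its values on 0/1-vectors, that is, on sets.\<close>
definition monomials :: "'a set \<Rightarrow> nat \<Rightarrow> ('a set \<Rightarrow> real) set" where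
  "monomials V d = (\<lambda>I X. of_bool (I \<subseteq> X)) ` {I. I \<subseteq> V \<and> card I \<le> d}"

lemma finite_monomials: "finite V \<Longrightarrow> finite (monomials V d)"
  by (simp add: monomials_def)

lemma card_monomials_le:
  assumes "finite V"
  shows "card (monomials V d) \<le> (\<Sum>i=0..d. card V choose i)"
proof -
  have "{I. I \<subseteq> V \<and> card I \<le> d} = (\<Union>i\<in>{0..d}. {I. I \<subseteq> V \<and> card I = i})" by auto
  then have "card {I. I \<subseteq> V \<and> card I \<le> d} \<le> (\<Sum>i=0..d. card {I. I \<subseteq> V \<and> card I = i})"
    by (simp add: card_UN_le)
  also have "\<dots> = (\<Sum>i=0..d. card V choose i)"
    using assms by (simp add: n_subsets)
  finally show ?thesis
    unfolding monomials_def using assms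
    by (intro le_trans[OF card_image_le]) auto
qed

lemma span_monomials_mono:
  "d \<le> e \<Longrightarrow> fun_space.span (monomials V d) \<subseteq> fun_space.span (monomials V e)"
  by (intro fun_space.span_mono) (auto simp: monomials_def)

text \<open>\<open>card (B \<inter> X)\<close> is the sum of the variables in \<open>B\<close>. On
  0/1-vectors squares of variables reduce to the variables, so a variable \<open>i\<close> times the
  monomial of \<open>I\<close> is the monomial of \<open>insert i I\<close>.\<close>

lemma span_monomials_mult_linear:
  assumes f: "f \<in> fun_space.span (monomials V d)" and V: "finite V" and B: "B \<subseteq> V"
  shows "(\<lambda>X. (real (card (B \<inter> X)) + c) * f X) \<in> fun_space.span (monomials V (Suc d))"
  using f
proof (induction rule: fun_space.span_induct_alt)
  case base
  then show ?case using fun_space.span_zero by (simp add: zero_fun_def)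
next
  case (step a m h)
  then obtain I where I: "I \<subseteq> V" "card I \<le> d" and m: "m = (\<lambda>X. of_bool (I \<subseteq> X))"
    by (auto simp: monomials_def)
  have finB: "finite B" using B V finite_subset by blast
  have ins: "(\<lambda>X. of_bool (insert i I \<subseteq> X)) \<in> fun_space.span (monomials V (Suc d))" if "i \<in> B" for i
  proof (rule fun_space.span_base)
    have "card (insert i I) \<le> Suc d"
      using I finite_subset[OF I(1) V] by (simp add: card_insert_if)
    then show "(\<lambda>X. of_bool (insert i I \<subseteq> X)) \<in> monomials V (Suc d)"
      using I that B unfolding monomials_def by (intro image_eqI[of _ _ "insert i I"]) auto
  qed
  have sum_apply: "(\<Sum>i\<in>B. (\<lambda>X. of_bool (insert i I \<subseteq> X))) X = (\<Sum>i\<in>B. of_bool (insert i I \<subseteq> X) :: real)" for X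
    using finB by (induction B rule: finite_induct) auto
  have card_sum: "real (card (B \<inter> X)) * of_bool (I \<subseteq> X) = (\<Sum>i\<in>B. of_bool (insert i I \<subseteq> X))" for X
    using finB by (cases "I \<subseteq> X") (auto simp: of_bool_def sum.If_cases Int_def)
  have "(\<lambda>X. (real (card (B \<inter> X)) + c) * m X)
      = (\<Sum>i\<in>B. (\<lambda>X. of_bool (insert i I \<subseteq> X))) + (\<lambda>X. c * m X)"
    unfolding fun_eq_iff plus_fun_apply sum_apply card_sum[symmetric] m
    by (simp add: algebra_simps)
  moreover have "m \<in> fun_space.span (monomials V (Suc d))"
    using I unfolding m monomials_def by (intro fun_space.span_base image_eqI[of _ _ I]) auto
  ultimately have "(\<lambda>X. (real (card (B \<inter> X)) + c) * m X) \<in> fun_space.span (monomials V (Suc d))"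
    using ins by (auto intro!: fun_space.span_add fun_space.span_scale fun_space.span_sum)
  then have "(\<lambda>X. a * ((real (card (B \<inter> X)) + c) * m X)) + (\<lambda>X. (real (card (B \<inter> X)) + c) * h X)
    \<in> fun_space.span (monomials V (Suc d))"
    using step.IH by (intro fun_space.span_add fun_space.span_scale)
  moreover have "(\<lambda>X. (real (card (B \<inter> X)) + c) * ((\<lambda>x. a * m x) + h) X)
    = (\<lambda>X. a * ((real (card (B \<inter> X)) + c) * m X)) + (\<lambda>X. (real (card (B \<inter> X)) + c) * h X)"
    by (rule ext) (simp add: algebra_simps)
  ultimately show ?case by simp
qed

lemma prod_linear_in_span_monomials:
  assumes K: "finite K" and V: "finite V" and B: "B \<subseteq> V"
  shows "(\<lambda>X. \<Prod>l\<in>K. real (card (B \<inter> X)) + c l) \<in> fun_space.span (monomials V (card K))"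
  using K
proof (induction K rule: finite_induct)
  case empty
  have "(\<lambda>X. 1) \<in> monomials V 0"
    unfolding monomials_def by (intro image_eqI[of _ _ "{}"]) auto
  then show ?case by (simp add: fun_space.span_base)
next
  case (insert l K)
  then show ?case using span_monomials_mult_linear[OF insert.IH V B] by simp
qed

section \<open>The polynomial bound for Sperner families\<close>

lemma sperner_familyD: "sperner_family F \<Longrightarrow> A \<in> F \<Longrightarrow> B \<in> F \<Longrightarrow> A \<subseteq> B \<Longrightarrow> A = B"
  by (auto simp: sperner_family_def)

lemma sperner_family_subset: "sperner_family F \<Longrightarrow> G \<subseteq> F \<Longrightarrow> sperner_family G"
  unfolding sperner_family_def by blast

lemma L_intersecting_subset: "L_intersecting L F \<Longrightarrow> G \<subseteq> F \<Longrightarrow> L_intersecting L G"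
  unfolding L_intersecting_def by blast

text \<open>Only elements of \<open>L\<close> below \<open>card A\<close> can be intersection sizes
  with \<open>A\<close>. Counting just those, instead of all of \<open>L\<close>, lets the bound be
  reused with \<open>s - 1\<close> for small sets.\<close>

lemma card_L_intersecting_sperner_le:
  assumes V: "finite V" "V \<noteq> {}" and F: "F \<subseteq> Pow V"
    and L: "L_intersecting L F" and sp: "sperner_family F"
    and d: "\<And>A. A \<in> F \<Longrightarrow> card (L \<inter> {..<card A}) \<le> d"
  shows "card F \<le> (\<Sum>i=0..d. (card V - 1) choose i)"
proof -
  obtain v where v: "v \<in> V" using V by blast
  let ?W = "V - {v}"
  let ?g = "\<lambda>A X. \<Prod>l\<in>L \<inter> {..<card A}. real (card (A \<inter> insert v X)) - real l"
  have finA: "finite A" if "A \<in> F" for A using that F V finite_subset by blast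
  have eq: "card (A \<inter> insert v X) = card ((A - {v}) \<inter> (X - {v})) + of_bool (v \<in> A)" if "A \<in> F" for A X
  proof -
    have "A \<inter> insert v X = ((A - {v}) \<inter> (X - {v})) \<union> (if v \<in> A then {v} else {})" by auto
    then show ?thesis using finA[OF that] by (auto simp: card_insert_if)
  qed
  have "card F \<le> card (monomials ?W d)"
  proof (rule card_le_of_triangular[where g = ?g and y = "\<lambda>A. A - {v}" and r = "\<lambda>A. of_bool (v \<notin> A)"])
    show "finite F" using F V by (meson finite_Pow_iff finite_subset)
    show "finite (monomials ?W d)" using V by (simp add: finite_monomials)
  next
    fix A assume A: "A \<in> F"
    \<comment> \<open>The point \<open>v\<close> contributes a constant, so each factor is a linear
      form in the variables of \<open>?W\<close> plus a constant.\<close>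
    have "card (A \<inter> insert v X) = card ((A - {v}) \<inter> X) + of_bool (v \<in> A)" for X
      unfolding eq[OF A] by (rule arg_cong2[where f = "(+)"]) (auto intro!: arg_cong[where f = card])
    then have "?g A = (\<lambda>X. \<Prod>l\<in>L \<inter> {..<card A}. real (card ((A - {v}) \<inter> X)) + (of_bool (v \<in> A) - real l))"
      by (simp add: add_diff_eq)
    also have "\<dots> \<in> fun_space.span (monomials ?W (card (L \<inter> {..<card A})))"
      using V F A by (intro prod_linear_in_span_monomials) auto
    finally show "?g A \<in> fun_space.span (monomials ?W d)"
      using span_monomials_mono d[OF A] by blast
    have "A \<inter> insert v (A - {v}) = A" by auto
    then show "?g A (A - {v}) \<noteq> 0" by simp
  next
    fix A B assume AB: "A \<in> F" "B \<in> F" "A \<noteq> B" "of_bool (v \<notin> B) \<le> (of_bool (v \<notin> A) :: nat)"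
    \<comment> \<open>Either \<open>v \<in> B\<close>, and the evaluation point gives back
      \<open>B\<close>, or \<open>v\<close> lies in neither set, and adding it to \<open>B\<close>
      does not affect the intersection with \<open>A\<close>.\<close>
    then have "A \<inter> insert v (B - {v}) = A \<inter> B" by (auto simp: of_bool_def split: if_splits)
    moreover have "card (A \<inter> B) \<in> L" using L AB by (auto simp: L_intersecting_def)
    moreover have "card (A \<inter> B) < card A"
      using sperner_familyD[OF sp AB(1,2)] AB(3) finA[OF AB(1)] by (intro psubset_card_mono) auto
    ultimately show "?g A (B - {v}) = 0" using AB by auto
  qed
  also have "\<dots> \<le> (\<Sum>i=0..d. card ?W choose i)" using V by (intro card_monomials_le) simp
  also have "card ?W = card V - 1" using v V by simp
  finally show ?thesis .
qed


section \<open>Antichains of sets of bounded size\<close>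

text \<open>If \<open>X\<close> is not a member, the inequality for \<open>X\<close> is the average
  of those for \<open>X - {x}\<close> over \<open>x \<in> X\<close>. Restricting to
  \<open>Pow X\<close> keeps \<open>F\<close> fixed in the induction.\<close>

lemma LYM_inequality:
  assumes "finite X" and "sperner_family F"
  shows "(\<Sum>A\<in>F \<inter> Pow X. 1 / real (card X choose card A)) \<le> 1"
  using assms(1)
proof (induction "card X" arbitrary: X)
  case 0
  then have "F \<inter> Pow X \<subseteq> {{}}" by auto
  then have "F \<inter> Pow X = {} \<or> F \<inter> Pow X = {{}}" by blast
  then show ?case by (elim disjE) (simp_all only: sum.empty, simp_all)
next
  case (Suc m)
  have fin: "finite (F \<inter> Pow X)" using Suc.prems by simp
  show ?case
  proof (cases "X \<in> F")
    case True
    then have "F \<inter> Pow X = {X}" using sperner_familyD[OF assms(2)] by blast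
    then show ?thesis by simp
  next
    case False
    \<comment> \<open>A member \<open>A\<close> survives the deletion of exactly
      \<open>Suc m - card A\<close> points; this identity turns its total weight over these
      deletions into \<open>Suc m\<close> times its weight in \<open>X\<close>.\<close>
    have weight: "(real (Suc m) - real (card A)) * (1 / real (m choose card A))
        = real (Suc m) * (1 / real (Suc m choose card A))" if "A \<in> F \<inter> Pow X" for A
    proof -
      have "A \<subset> X" using that False by auto
      then have "card A < card X" using Suc.prems by (simp add: psubset_card_mono)
      then have le: "card A \<le> m" using Suc.hyps by simp
      have "(Suc m - card A) * (Suc m choose card A) = Suc m * (m choose card A)"
        using binomial_absorb_comp[of "Suc m" "card A"] by simp
      then have "real (Suc m - card A) * real (Suc m choose card A) = real (Suc m) * real (m choose card A)"
        unfolding of_nat_mult[symmetric] by (rule arg_cong)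
      then show ?thesis
        using le unfolding times_divide_eq_right mult_1_right
        by (subst frac_eq_eq) (auto simp: of_nat_diff)
    qed
    have "real (Suc m) * (\<Sum>A\<in>F \<inter> Pow X. 1 / real (Suc m choose card A))
        = (\<Sum>A\<in>F \<inter> Pow X. (real (Suc m) - real (card A)) * (1 / real (m choose card A)))"
      unfolding sum_distrib_left by (intro sum.cong refl weight[symmetric])
    also have "\<dots> = (\<Sum>A\<in>F \<inter> Pow X. \<Sum>x\<in>X. if x \<notin> A then 1 / real (m choose card A) else 0)"
    proof (intro sum.cong refl)
      fix A assume A: "A \<in> F \<inter> Pow X"
      have "X \<inter> {x. x \<notin> A} = X - A" by auto
      moreover have "real (card (X - A)) = real (Suc m) - real (card A)"
        using A Suc.prems Suc.hyps(2) card_mono[of X A] finite_subset[of A X]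
        by (simp add: card_Diff_subset of_nat_diff)
      ultimately show "(real (Suc m) - real (card A)) * (1 / real (m choose card A))
          = (\<Sum>x\<in>X. if x \<notin> A then 1 / real (m choose card A) else 0)"
        using Suc.prems by (simp add: sum.If_cases)
    qed
    also have "\<dots> = (\<Sum>x\<in>X. \<Sum>A\<in>F \<inter> Pow X. if x \<notin> A then 1 / real (m choose card A) else 0)"
      by (rule sum.swap)
    also have "\<dots> = (\<Sum>x\<in>X. \<Sum>A\<in>F \<inter> Pow (X - {x}). 1 / real (card (X - {x}) choose card A))"
    proof (rule sum.cong[OF refl])
      fix x assume "x \<in> X"
      then have "card (X - {x}) = m" using Suc by simp
      moreover have "(F \<inter> Pow X) \<inter> {A. x \<notin> A} = F \<inter> Pow (X - {x})" by auto
      ultimately show "(\<Sum>A\<in>F \<inter> Pow X. if x \<notin> A then 1 / real (m choose card A) else 0)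
          = (\<Sum>A\<in>F \<inter> Pow (X - {x}). 1 / real (card (X - {x}) choose card A))"
        using fin by (simp add: sum.If_cases)
    qed
    also have "\<dots> \<le> (\<Sum>x\<in>X. 1)"
      using Suc by (intro sum_mono Suc.hyps(1)) auto
    also have "\<dots> = real (Suc m) * 1" using Suc.hyps by simp
    finally have "(\<Sum>A\<in>F \<inter> Pow X. 1 / real (Suc m choose card A)) \<le> 1"
      by (rule mult_left_le_imp_le) simp
    then show ?thesis using Suc.hyps by simp
  qed
qed

text \<open>Binomial coefficients increase strictly up to \<open>s\<close>, so each LYM term is at
  least the one for size \<open>s\<close>, and strictly larger for a smaller set.\<close>

lemma sperner_family_card_le:
  assumes X: "finite X" and F: "F \<subseteq> Pow X" "sperner_family F"
    and s: "2 * s \<le> card X" "\<And>A. A \<in> F \<Longrightarrow> card A \<le> s"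
  shows "card F \<le> card X choose s"
    and "card F = card X choose s \<Longrightarrow> F = {A. A \<subseteq> X \<and> card A = s}"
proof -
  let ?N = "real (card X choose s)"
  have finF: "finite F" using F X by (meson finite_Pow_iff finite_subset)
  have pos: "0 < ?N" using s by simp
  have le1: "(\<Sum>A\<in>F. 1 / real (card X choose card A)) \<le> 1"
    using LYM_inequality[OF X F(2)] F(1) by (simp add: Int_absorb2)
  have pos': "0 < real (card X choose card A)" if "A \<in> F" for A
    using s(1) s(2)[OF that] by simp
  have term_le: "1 / ?N \<le> 1 / real (card X choose card A)" if "A \<in> F" for A
    using binomial_mono[OF s(2)[OF that] s(1)] pos'[OF that] by (simp add: frac_le)
  have sum: "real (card F) / ?N = (\<Sum>A\<in>F. 1 / ?N)" by simp
  also have "\<dots> \<le> (\<Sum>A\<in>F. 1 / real (card X choose card A))" by (intro sum_mono term_le)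
  also note le1
  finally show "card F \<le> card X choose s" using pos by (simp add: field_simps)
  assume eq: "card F = card X choose s"
  have "card A = s" if A: "A \<in> F" for A
  proof (rule ccontr)
    assume "card A \<noteq> s"
    then have "(card X choose card A) < card X choose s"
      using s(1) s(2)[OF A] by (intro binomial_strict_mono) auto
    then have "1 / ?N < 1 / real (card X choose card A)"
      using pos'[OF A] by (simp add: frac_less2)
    then have "(\<Sum>A\<in>F. 1 / ?N) < (\<Sum>A\<in>F. 1 / real (card X choose card A))"
      using A finF term_le by (intro sum_strict_mono_ex1) auto
    then show False using sum le1 eq pos by simp
  qed
  then have "F \<subseteq> {A. A \<subseteq> X \<and> card A = s}" using F by auto
  then show "F = {A. A \<subseteq> X \<and> card A = s}"
    using eq X by (intro card_subset_eq) (auto simp: n_subsets)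
qed

section \<open>The case of an initial segment \<open>L\<close>\<close>

lemma initial_L_intersecting_sperner:
  assumes X: "finite X" and F: "F \<subseteq> Pow X" "sperner_family F" "L_intersecting {0..<s} F"
    and s: "0 < s" "2 * s \<le> card X"
  shows "card F \<le> card X choose s"
    and "card F = card X choose s \<Longrightarrow> F = {A. A \<subseteq> X \<and> card A = s}"
proof -
  have fin: "finite A" if "A \<in> F" for A using that F(1) X finite_subset by blast
  have inter: "card (A \<inter> B) < s" if "A \<in> F" "B \<in> F" "A \<noteq> B" for A B
    using F(3) that by (auto simp: L_intersecting_def)
  \<comment> \<open>The choice is over all sets; an infinite one has \<open>card\<close> 0 and
    admits the empty subset.\<close>
  have "\<forall>A :: 'a set. \<exists>T. T \<subseteq> A \<and> card T = min s (card A)"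
    by (rule allI, rule obtain_subset_with_card_n[OF min.cobounded2]) auto
  then obtain \<phi> where "\<forall>A :: 'a set. \<phi> A \<subseteq> A \<and> card (\<phi> A) = min s (card A)"
    by (rule choice[THEN exE])
  then have \<phi>: "\<phi> A \<subseteq> A" "card (\<phi> A) = min s (card A)" for A :: "'a set" by auto
  have \<phi>_id: "\<phi> A = A" if "A \<in> F" "card A \<le> s" for A
    using \<phi> that fin by (simp add: card_subset_eq)
  have anti: "A = B" if AB: "A \<in> F" "B \<in> F" "\<phi> A \<subseteq> \<phi> B" for A B
  proof (rule ccontr)
    assume "A \<noteq> B"
    \<comment> \<open>The intersection has fewer than \<open>s\<close> points, so \<open>A\<close>
      was not shrunk, and \<open>A \<subseteq> B\<close> contradicts the Sperner property.\<close>
    have "card (\<phi> A) \<le> card (A \<inter> B)"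
      using AB \<phi>(1) fin by (intro card_mono finite_Int) blast+
    then have "card A \<le> s" using inter[OF AB(1,2) \<open>A \<noteq> B\<close>] \<phi>(2)[of A] by linarith
    then have "A \<subseteq> B" using \<phi>_id AB \<phi>(1) by blast
    then show False using sperner_familyD[OF F(2)] AB \<open>A \<noteq> B\<close> by blast
  qed
  have card_eq: "card (\<phi> ` F) = card F"
    using anti by (intro card_image inj_onI) blast
  have sp: "sperner_family (\<phi> ` F)"
    using anti unfolding sperner_family_def by blast
  have sub: "\<phi> ` F \<subseteq> Pow X" using \<phi>(1) F(1) by blast
  have le: "card A \<le> s" if "A \<in> \<phi> ` F" for A using that \<phi>(2) by auto
  note bound = sperner_family_card_le[OF X sub sp s(2) le]
  show "card F \<le> card X choose s" using bound(1) card_eq by simp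
  assume "card F = card X choose s"
  then have all: "\<phi> ` F = {A. A \<subseteq> X \<and> card A = s}" using bound(2) card_eq by simp
  \<comment> \<open>Otherwise exchange a point of \<open>\<phi> A\<close> for one of
    \<open>A\<close> outside it. In the equality case the new \<open>s\<close>-set is
    \<open>\<phi> B\<close> for another member \<open>B\<close>, which then meets \<open>A\<close>
    in at least \<open>s\<close> points.\<close>
  have "\<phi> A = A" if A: "A \<in> F" for A
  proof (rule ccontr)
    assume "\<phi> A \<noteq> A"
    then obtain x where x: "x \<in> A" "x \<notin> \<phi> A" using \<phi>(1) by blast
    have finA: "finite (\<phi> A)" using \<phi>(1) fin[OF A] finite_subset by blast
    have cA: "card (\<phi> A) = s" using all A by blast
      obtain y where y: "y \<in> \<phi> A" using cA s(1) by fastforce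
      let ?T = "insert x (\<phi> A - {y})"
      have "card ?T = s" using finA x y cA s(1) by simp
      moreover have T: "?T \<subseteq> A" using x \<phi>(1) by blast
      ultimately have "?T \<in> \<phi> ` F" using all F(1) A by blast
      then obtain B where B: "B \<in> F" "?T = \<phi> B" by blast
      have "B \<noteq> A" using B(2) x by auto
      moreover have "card ?T \<le> card (A \<inter> B)"
        using T B \<phi>(1) fin[OF A] by (intro card_mono finite_Int) blast+
      ultimately show False using inter[OF A B(1)] \<open>card ?T = s\<close> by simp
  qed
  then show "F = {A. A \<subseteq> X \<and> card A = s}" using all by force
qed

section \<open>Estimates for partial sums of binomial coefficients\<close>

text \<open>Geometric series bound with ratio \<open>k / (m - k + 1)\<close>, the quotient of the
  last two coefficients, cleared of denominators.\<close>

lemma sum_binomial_le: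
  assumes "2 * k \<le> m"
  shows "(\<Sum>i=0..k. real (m choose i)) * (real m - 2 * real k + 1) \<le> (real m - real k + 1) * real (m choose k)"
  using assms
proof (induction k)
  case 0
  then show ?case by simp
next
  case (Suc k)
  let ?T = "\<Sum>i=0..k. real (m choose i)" and ?c = "real (m choose k)" and ?c' = "real (m choose Suc k)"
  let ?a = "real m - 2 * real k"
  have a: "2 \<le> ?a" using of_nat_mono[OF Suc.prems, where 'a = real] by simp
  have IH: "?T * (?a + 1) \<le> (real m - real k + 1) * ?c" using Suc by simp
  have "Suc k * (m choose Suc k) = (m - k) * (m choose k)"
    using times_binomial_minus1_eq[of "Suc k" m] binomial_absorb_comp[of m k] by simp
  then have "real (Suc k) * ?c' = real (m - k) * ?c"
    unfolding of_nat_mult[symmetric] by (rule arg_cong)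
  then have absorb: "(real k + 1) * ?c' = (real m - real k) * ?c"
    using Suc.prems by (simp add: of_nat_diff add.commute)
  \<comment> \<open>The two sides differ by \<open>m + 1\<close>.\<close>
  have "(real m - real k + 1) * (?a - 1) \<le> (real m - real k) * (?a + 1)"
    by (simp add: algebra_simps)
  then have "((real m - real k + 1) * (?a - 1)) * ?c \<le> ((real m - real k) * (?a + 1)) * ?c"
    by (rule mult_right_mono) simp
  moreover have "(?T * (?a + 1)) * (?a - 1) \<le> ((real m - real k + 1) * ?c) * (?a - 1)"
    using a by (intro mult_right_mono[OF IH]) simp
  ultimately have "(?T * (?a - 1)) * (?a + 1) \<le> ((real m - real k) * ?c) * (?a + 1)"
    by (simp add: mult_ac)
  then have "?T * (?a - 1) \<le> (real m - real k) * ?c"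
    by (rule mult_right_le_imp_le) (use a in simp)
  then have "?T * (?a - 1) \<le> (real k + 1) * ?c'" by (simp only: absorb)
  then show ?case by (simp add: algebra_simps)
qed

text \<open>The left side is \<open>s + 1\<close> times the bound for the small members plus the
  incidence bound, \<open>n\<close> times the same sum, for the large ones.\<close>

lemma sum_binomial_less:
  assumes s: "0 < s" and n: "3 * s\<^sup>2 \<le> n"
  shows "(n + s + 1) * (\<Sum>i=0..s - 1. (n - 1) choose i) < (s + 1) * (n choose s)"
proof -
  let ?T = "\<Sum>i=0..s - 1. real ((n - 1) choose i)" and ?c = "real ((n - 1) choose (s - 1))"
  define x y where "x = real s" and "y = real n"
  have x: "1 \<le> x" and y: "3 * x\<^sup>2 \<le> y"
    using s of_nat_mono[OF n, where 'a = real] unfolding x_def y_def by simp_all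
  have sq: "2 * x \<le> 1 + x\<^sup>2" using sum_squares_bound[of x 1] by simp
  have "x \<le> x\<^sup>2" using x by (simp add: power2_eq_square)
  then have gap: "0 < y - 2 * x + 2" "x < y" using x y by linarith+
  have "n > 0" "2 * (s - 1) \<le> n - 1" using gap(1) x s unfolding x_def y_def by linarith+
  then have T: "?T * (y - 2 * x + 2) \<le> (y - x + 1) * ?c"
    using sum_binomial_le[of "s - 1" "n - 1"] s by (simp add: x_def y_def of_nat_diff algebra_simps)
  have cpos: "0 < ?c" using \<open>2 * (s - 1) \<le> n - 1\<close> by simp
  \<comment> \<open>What remains after bounding \<open>?T\<close> by the geometric estimate and
    writing \<open>n choose s\<close> through \<open>?c\<close>. The hypothesis
    \<open>3 * x\<^sup>2 \<le> y\<close> makes the second factor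
    \<open>y - 2 * x\<^sup>2 - 2 * x + 2\<close> at least
    \<open>(x - 1)\<^sup>2 + 1\<close>.\<close>
  have poly: "x * (y + x + 1) * (y - x + 1) < y * (x + 1) * (y - 2 * x + 2)"
  proof -
    have "y * (x + 1) * (y - 2 * x + 2) - x * (y + x + 1) * (y - x + 1)
      = y * (y - 2 * x\<^sup>2 - 2 * x + 2) + x * (x + 1) * (x - 1)"
      by (simp add: algebra_simps power2_eq_square)
    moreover have "0 < y * (y - 2 * x\<^sup>2 - 2 * x + 2)"
      using x y sq \<open>x \<le> x\<^sup>2\<close> by (intro mult_pos_pos) linarith+
    moreover have "0 \<le> x * (x + 1) * (x - 1)" using x by simp
    ultimately show ?thesis by linarith
  qed
  have "s * (n choose s) = n * ((n - 1) choose (s - 1))"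
    using s by (simp add: times_binomial_minus1_eq)
  then have absorb: "x * real (n choose s) = y * ?c"
    unfolding x_def y_def of_nat_mult[symmetric] by (rule arg_cong)
  have "(x * (y + x + 1) * ?T) * (y - 2 * x + 2) \<le> (x * (y + x + 1)) * ((y - x + 1) * ?c)"
    using mult_left_mono[OF T, of "x * (y + x + 1)"] x gap by (simp add: mult.assoc)
  also have "\<dots> = (x * (y + x + 1) * (y - x + 1)) * ?c" by (simp add: mult.assoc)
  also have "\<dots> < (y * (x + 1) * (y - 2 * x + 2)) * ?c" by (rule mult_strict_right_mono[OF poly cpos])
  also have "\<dots> = (x + 1) * (y * ?c) * (y - 2 * x + 2)" by (simp add: mult_ac)
  also have "\<dots> = (x * ((x + 1) * real (n choose s))) * (y - 2 * x + 2)" 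
    unfolding absorb[symmetric] by (simp add: mult_ac)
  finally have "x * (y + x + 1) * ?T < x * ((x + 1) * real (n choose s))"
    using gap by (simp only: mult_less_cancel_right_pos)
  then have "(y + x + 1) * ?T < (x + 1) * real (n choose s)"
    using x by (simp add: mult.assoc)
  then have "real ((n + s + 1) * (\<Sum>i=0..s - 1. (n - 1) choose i)) < real ((s + 1) * (n choose s))"
    unfolding x_def y_def by (simp add: algebra_simps)
  then show ?thesis by (simp only: of_nat_less_iff)
qed

section \<open>The case of any other \<open>L\<close> containing 0\<close>

lemma noninitial_L_intersecting_sperner_less:
  assumes s: "0 < s" and n: "3 * s\<^sup>2 \<le> card X" and X: "finite X"
    and L: "finite L" "card L = s" "0 \<in> L" "L \<noteq> {0..<s}"
    and F: "F \<subseteq> Pow X" "L_intersecting L F" "sperner_family F"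
  shows "card F < card X choose s"
proof -
  let ?n = "card X" and ?T = "\<Sum>i=0..s - 1. (card X - 1) choose i"
  define small big where "small = {A \<in> F. card A \<le> s}" and "big = {A \<in> F. s < card A}"
  have finF: "finite F" using F X by (meson finite_Pow_iff finite_subset)
  have "0 < s\<^sup>2" using s by simp
  then have Xne: "X \<noteq> {}" using n by auto
  have split: "card F = card small + card big"
  proof -
    have "F = small \<union> big" "small \<inter> big = {}" by (auto simp: small_def big_def)
    then show ?thesis using finF by (simp add: card_Un_disjoint)
  qed
  have "card small \<le> ?T"
  proof (rule card_L_intersecting_sperner_le[OF X Xne])
    have "small \<subseteq> F" by (auto simp: small_def)
    then show "small \<subseteq> Pow X" "L_intersecting L small" "sperner_family small"
      using F by (auto intro: L_intersecting_subset sperner_family_subset)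
    fix A assume "A \<in> small"
    then have sub: "L \<inter> {..<card A} \<subseteq> L \<inter> {0..<s}" by (auto simp: small_def)
    \<comment> \<open>With \<open>s\<close> elements and not equal to \<open>{0..<s}\<close>,
      \<open>L\<close> has an element that is at least \<open>s\<close>.\<close>
    have "L \<inter> {0..<s} \<noteq> L"
      using L card_subset_eq[of "{0..<s}" L] by auto
    then have "card (L \<inter> {0..<s}) < card L" using L by (intro psubset_card_mono) auto
    moreover have "card (L \<inter> {..<card A}) \<le> card (L \<inter> {0..<s})" using sub L by (intro card_mono) auto
    ultimately show "card (L \<inter> {..<card A}) \<le> s - 1" using L by linarith
  qed
  moreover have star: "card {A \<in> big. x \<in> A} \<le> ?T" for x
  proof (rule card_L_intersecting_sperner_le[OF X Xne])
    have "{A \<in> big. x \<in> A} \<subseteq> F" by (auto simp: big_def)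
    then show "{A \<in> big. x \<in> A} \<subseteq> Pow X" "sperner_family {A \<in> big. x \<in> A}"
      using F by (auto intro: sperner_family_subset)
    \<comment> \<open>The common point \<open>x\<close> excludes empty intersections, and
      \<open>0 \<in> L\<close> makes this remove one value.\<close>
    show "L_intersecting (L - {0}) {A \<in> big. x \<in> A}"
      unfolding L_intersecting_def
    proof (intro ballI impI)
      fix A B assume AB: "A \<in> {A \<in> big. x \<in> A}" "B \<in> {A \<in> big. x \<in> A}" "A \<noteq> B"
      then have "finite (A \<inter> B)" "x \<in> A \<inter> B"
        using F(1) X by (auto simp: big_def intro: finite_subset)
      then have "card (A \<inter> B) \<noteq> 0" by auto
      then show "card (A \<inter> B) \<in> L - {0}"
        using F(2) AB by (auto simp: L_intersecting_def big_def)
    qed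
    fix A :: "'a set"
    have "card ((L - {0}) \<inter> {..<card A}) \<le> card (L - {0})" using L by (intro card_mono) auto
    then show "card ((L - {0}) \<inter> {..<card A}) \<le> s - 1" using L by simp
  qed
  \<comment> \<open>Incidences counted twice: each large member has at least \<open>s + 1\<close>
    points, and each point is in at most \<open>?T\<close> of them.\<close>
  have "(s + 1) * card big \<le> ?n * ?T"
  proof -
    have fb: "finite big" using finF by (simp add: big_def)
    have "(s + 1) * card big = (\<Sum>A\<in>big. s + 1)" by simp
    also have "\<dots> \<le> (\<Sum>A\<in>big. card A)" by (intro sum_mono) (auto simp: big_def)
    also have "\<dots> = (\<Sum>A\<in>big. \<Sum>x\<in>X. of_bool (x \<in> A))"
    proof (intro sum.cong refl)
      fix A assume "A \<in> big"
      then have "X \<inter> {x. x \<in> A} = A" using F(1) by (auto simp: big_def)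
      then show "card A = (\<Sum>x\<in>X. of_bool (x \<in> A))"
        using X by (simp add: of_bool_def sum.If_cases)
    qed
    also have "\<dots> = (\<Sum>x\<in>X. \<Sum>A\<in>big. of_bool (x \<in> A))" by (rule sum.swap)
    also have "\<dots> = (\<Sum>x\<in>X. card {A \<in> big. x \<in> A})"
      using fb by (simp add: of_bool_def sum.If_cases Int_def)
    also have "\<dots> \<le> (\<Sum>x\<in>X. ?T)" by (intro sum_mono star)
    finally show ?thesis by simp
  qed
  ultimately have "(s + 1) * card F \<le> (?n + s + 1) * ?T"
    using mult_le_mono2[of "card small" ?T "s + 1"] by (simp add: split algebra_simps)
  then have "(s + 1) * card F < (s + 1) * (?n choose s)"
    using sum_binomial_less[OF s n] by linarith
  then show ?thesis by (simp only: mult_less_cancel1)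
qed

theorem theorem1p4:
  fixes n s :: nat and L :: "nat set" and \<F> :: "nat set set"
  assumes "n > 0" and "s > 0"
    and "finite L" and "card L = s"
    and "\<F> \<subseteq> Pow {1..n}"
    and "L_intersecting L \<F>" and "sperner_family \<F>"
  shows "card \<F> \<le> (\<Sum>i=0..s. (n - 1) choose i) \<and>
    (0 \<in> L \<and> n \<ge> 3 * s\<^sup>2 \<longrightarrow>
      card \<F> \<le> n choose s \<and>
      (card \<F> = n choose s \<longleftrightarrow>
        L = {0..<s} \<and> \<F> = {A. A \<subseteq> {1..n} \<and> card A = s}))"
proof (intro conjI impI)
  have "card (L \<inter> {..<card A}) \<le> s" for A :: "nat set"
    using assms(3,4) by (metis Int_lower1 card_mono)
  then show "card \<F> \<le> (\<Sum>i=0..s. (n - 1) choose i)"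
    using card_L_intersecting_sperner_le[of "{1..n}" \<F> L s] assms by simp
next
  assume *: "0 \<in> L \<and> n \<ge> 3 * s\<^sup>2"
  have "s \<le> s\<^sup>2" by (simp add: power2_eq_square)
  then have n: "2 * s \<le> card {1..n}" using * by simp
  \<comment> \<open>Strictness gives the bound and also shows that equality forces
    \<open>L = {0..<s}\<close>.\<close>
  have less: "card \<F> < n choose s" if "L \<noteq> {0..<s}"
    using noninitial_L_intersecting_sperner_less[of s "{1..n}" L \<F>] that assms * by simp
  have init: "card \<F> \<le> n choose s"
    "card \<F> = n choose s \<Longrightarrow> \<F> = {A. A \<subseteq> {1..n} \<and> card A = s}" if "L = {0..<s}"
    using initial_L_intersecting_sperner[of "{1..n}" \<F> s] that assms n by auto
  show "card \<F> \<le> n choose s" using less init(1) by (cases "L = {0..<s}") auto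
  show "card \<F> = n choose s \<longleftrightarrow> L = {0..<s} \<and> \<F> = {A. A \<subseteq> {1..n} \<and> card A = s}"
  proof
    assume "card \<F> = n choose s"
    then show "L = {0..<s} \<and> \<F> = {A. A \<subseteq> {1..n} \<and> card A = s}" using less init(2) by (cases "L = {0..<s}") auto
  next
    assume "L = {0..<s} \<and> \<F> = {A. A \<subseteq> {1..n} \<and> card A = s}"
    then show "card \<F> = n choose s" by (simp add: n_subsets)
  qed
qed

end
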